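(* Let $m\ge 2$, $d\ge 2$ be integers and let $\alpha_v^{ij}\in\mathbb{R}$ ($v\in[d]$, $i,j\in[m]$) satisfy $\alpha_v^{ij}=\alpha_v^{ji}$. Let $F:\mathfrak{D}\to \mathrm{T}\mathfrak{D}$, $F(x)=-x+\pi(x)$, be the associated vector field. Then the continuous function $L:\mathfrak{D}\to\mathbb{R}$ defined by $$L(x)=\sum_{i=1}^m\sum_{v=1}^d x_v^i\log(x_v^i)-\frac12\sum_{i=1}^m\sum_{j=1}^m\sum_{v=1}^d\alpha_v^{ij}x_v^ix_v^j,\qquad 0\log(0)=0,$$ is a strict Lyapunov function for the vector field $F$.
   Context: Notation: $[n]=\{1,\dots,n\}$. $\triangle=\{x=(x_v)\in\mathbb{R}^d: x_v\ge 0,\ \sum_v x_v=1\}$ and $\mathfrak{D}=\triangle^m\subset\mathbb{R}^{dm}$, with points written $x=(x_v^i)_{i\in[m],v\in[d]}$, where $x^i=(x^i_1,\dots,x^i_d)\in\triangle$. $\mathrm{T}\mathfrak{D}=\{x\in\mathbb{R}^{dm}:\sum_v x_v^i=0\text{ for each }i\in[m]\}$. The map $\pi=(\pi_v^i):\mathfrak{D}\to\mathfrak{D}$ is $$\pi_v^i(x)=\frac{\exp\big(\sum_{j=1}^m\alpha_v^{ij}x_v^j\big)}{\sum_{u=1}^d\exp\big(\sum_{j=1}^m\alpha_u^{ij}x_u^j\big)}.$$ $F^{-1}(0)=\{x\in\mathfrak{D}:F(x)=0\}$ is the set of equilibria. $\Phi=\{\phi_t\}_{t\ge0}$ denotes the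 semi-flow on $\mathfrak{D}$ associated with $F$: $t\mapsto\phi_t(x_0)\in\mathfrak D$ is the unique solution on $[0,\infty)$ of $\dot x=F(x)$, $x(0)=x_0\in\mathfrak{D}$. Definition (strict Lyapunov function): a continuous function $L:\mathfrak{D}\to\mathbb{R}$ is a strict Lyapunov function for $F$ if the function $t\in[0,\infty)\mapsto L(\phi_t(x_0))$ is strictly decreasing for all $x_0\in\mathfrak{D}\setminus F^{-1}(0)$. *)

theory Defs
  imports "HOL-Analysis.Analysis"
begin

text \<open>Points of \<open>\<real>\<^sup>d\<^sup>m\<close> have type \<open>real ^ 'd ^ 'm\<close>: the coordinate \<open>x\<^sub>v\<^sup>i\<close> is \<open>x $ i $ v\<close>,
  and \<open>\<alpha>\<^sub>v\<^sup>i\<^sup>j\<close> is \<open>\<alpha> v i j\<close>.\<close>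

definition prob_simplex :: "(real ^ 'd) set" where
  "prob_simplex = {x. (\<forall>v. 0 \<le> x $ v) \<and> (\<Sum>v\<in>UNIV. x $ v) = 1}"

definition polysimplex :: "(real ^ 'd ^ 'm) set" where
  "polysimplex = {x. \<forall>i. x $ i \<in> prob_simplex}"

definition polysimplex_tangent :: "(real ^ 'd ^ 'm) set" where
  "polysimplex_tangent = {x. \<forall>i. (\<Sum>v\<in>UNIV. x $ i $ v) = 0}"

definition choice_map ::
    "('d \<Rightarrow> 'm \<Rightarrow> 'm \<Rightarrow> real) \<Rightarrow> real ^ 'd ^ 'm \<Rightarrow> real ^ 'd ^ 'm" where
  "choice_map \<alpha> x = (\<chi> i v.
     exp (\<Sum>j\<in>UNIV. \<alpha> v i j * x $ j $ v) /
     (\<Sum>u\<in>UNIV. exp (\<Sum>j\<in>UNIV. \<alpha> u i j * x $ j $ u)))"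

definition vector_field ::
    "('d \<Rightarrow> 'm \<Rightarrow> 'm \<Rightarrow> real) \<Rightarrow> real ^ 'd ^ 'm \<Rightarrow> real ^ 'd ^ 'm" where
  "vector_field \<alpha> x = - x + choice_map \<alpha> x"

definition equilibria :: "(real ^ 'd ^ 'm \<Rightarrow> real ^ 'd ^ 'm) \<Rightarrow> (real ^ 'd ^ 'm) set" where
  "equilibria F = {x \<in> polysimplex. F x = 0}"

definition is_trajectory ::
    "(real ^ 'd ^ 'm \<Rightarrow> real ^ 'd ^ 'm) \<Rightarrow> real ^ 'd ^ 'm \<Rightarrow> (real \<Rightarrow> real ^ 'd ^ 'm) \<Rightarrow> bool" where
  "is_trajectory F x0 x \<longleftrightarrow>
     x 0 = x0 \<and>
     (\<forall>t\<in>{0..}. x t \<in> polysimplex \<and>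
        (x has_vector_derivative F (x t)) (at t within {0..}))"

text \<open>\<open>semiflow F t x0\<close> is \<open>\<phi>\<^sub>t(x0)\<close>. A trajectory is unconstrained at negative times, so
  uniqueness can only be asked of its value at time \<open>t \<ge> 0\<close>, not of the function on \<open>\<real>\<close>.\<close>

definition semiflow ::
    "(real ^ 'd ^ 'm \<Rightarrow> real ^ 'd ^ 'm) \<Rightarrow> real \<Rightarrow> real ^ 'd ^ 'm \<Rightarrow> real ^ 'd ^ 'm" where
  "semiflow F t x0 = (THE y. \<exists>x. is_trajectory F x0 x \<and> y = x t)"

definition strict_lyapunov ::
    "(real ^ 'd ^ 'm \<Rightarrow> real ^ 'd ^ 'm) \<Rightarrow> (real ^ 'd ^ 'm \<Rightarrow> real) \<Rightarrow> bool" where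
  "strict_lyapunov F L \<longleftrightarrow>
     continuous_on polysimplex L \<and>
     (\<forall>x0 \<in> polysimplex - equilibria F.
        strict_antimono_on {0..} (\<lambda>t. L (semiflow F t x0)))"

text \<open>The convention \<open>0 log 0 = 0\<close> needs no case distinction, since \<open>0 * ln 0 = 0\<close>.\<close>

definition lyapunov_fun :: "('d \<Rightarrow> 'm \<Rightarrow> 'm \<Rightarrow> real) \<Rightarrow> real ^ 'd ^ 'm \<Rightarrow> real" where
  "lyapunov_fun \<alpha> x =
     (\<Sum>i\<in>UNIV. \<Sum>v\<in>UNIV. x $ i $ v * ln (x $ i $ v)) -
     1 / 2 * (\<Sum>i\<in>UNIV. \<Sum>j\<in>UNIV. \<Sum>v\<in>UNIV. \<alpha> v i j * x $ i $ v * x $ j $ v)"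

lemma choice_map_in_polysimplex: "choice_map \<alpha> x \<in> polysimplex"
proof -
  have "(\<Sum>u\<in>UNIV. exp (\<Sum>j\<in>UNIV. \<alpha> u i j * x $ j $ u)) > 0" for i
    by (intro sum_pos) auto
  then show ?thesis
    by (simp add: polysimplex_def prob_simplex_def choice_map_def less_imp_le less_imp_neq[symmetric]
        flip: sum_divide_distrib)
qed

lemma vector_field_in_tangent:
  assumes "x \<in> polysimplex"
  shows "vector_field \<alpha> x \<in> polysimplex_tangent"
  using assms choice_map_in_polysimplex[of \<alpha> x]
  by (simp add: vector_field_def polysimplex_tangent_def polysimplex_def prob_simplex_def
      sum_subtractf)

end

theory Submission
  imports Defs "HOL-Real_Asymp.Real_Asymp"
begin

text \<open>Along a trajectory in the interior of the polysimplex, the symmetry of \<open>\<alpha>\<close> gives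
  \<open>\<partial>L/\<partial>x\<^sub>v\<^sup>i = ln x\<^sub>v\<^sup>i + 1 - \<Sum>\<^sub>j \<alpha>\<^sub>v\<^sup>i\<^sup>j x\<^sub>v\<^sup>j\<close>. The last sum is \<open>ln \<pi>\<^sub>v\<^sup>i(x)\<close> up to a constant
  depending only on \<open>i\<close>, and constants in each block \<open>i\<close> are annihilated by the tangent vector
  \<open>\<pi>(x) - x\<close>. Hence
  \<open>dL/dt = \<Sum>\<^sub>i \<Sum>\<^sub>v (ln x\<^sub>v\<^sup>i - ln \<pi>\<^sub>v\<^sup>i(x)) (\<pi>\<^sub>v\<^sup>i(x) - x\<^sub>v\<^sup>i)\<close>,
  whose terms are nonpositive because \<open>ln\<close> is strictly increasing, and whose value is negative
  unless \<open>x = \<pi>(x)\<close> (\<open>lyapunov_fun_has_derivative\<close>, \<open>lyapunov_derivative_neg\<close>).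

  Three properties of the flow turn this into a strict decrease on \<open>[0, \<infinity>)\<close>. The field is globally
  Lipschitz (\<open>vector_field_lipschitz\<close>), so trajectories exist for all time and are unique, and the
  semiflow is what its definition intends (\<open>semiflow_trajectory\<close>). Since \<open>\<pi> > 0\<close>, the function
  \<open>e\<^sup>t x\<^sub>v\<^sup>i\<close> is strictly increasing, so a trajectory is in the interior at every time \<open>t > 0\<close>, even
  if it starts on the boundary, where \<open>L\<close> is continuous but not differentiable
  (\<open>solution_interior\<close>). Finally, by uniqueness backwards in time, a trajectory that starts off
  the equilibria never reaches one (\<open>trajectory_avoids_equilibria\<close>). So \<open>L\<close> is continuous along the
  trajectory on \<open>[s, t]\<close> with negative derivative on \<open>(s, t)\<close>, and the mean value theorem applies.\<close>

section \<open>Differential equations with a Lipschitz right-hand side\<close>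

text \<open>The estimate behind the weighted sup norm \<open>sup\<^sub>t e\<^sup>-\<^sup>l\<^sup>t |x(t)|\<close>: integration from \<open>0\<close> to \<open>t\<close> gains
  a factor \<open>1 / l\<close> in this norm, so it can be made as small as needed by enlarging \<open>l\<close>.\<close>

lemma norm_integral_le_exp:
  fixes f :: "real \<Rightarrow> 'a::euclidean_space"
  assumes "0 < l" "0 \<le> t" "0 \<le> C" and cont: "continuous_on {0..t} f"
    and bound: "\<And>s. 0 \<le> s \<Longrightarrow> s \<le> t \<Longrightarrow> norm (f s) \<le> C * exp (l * s)"
  shows "norm (integral {0..t} f) \<le> C / l * exp (l * t)"
proof -
  have int: "((\<lambda>s. C * exp (l * s)) has_integral C / l * exp (l * t) - C / l * exp (l * 0)) {0..t}"
    using assms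
    by (intro fundamental_theorem_of_calculus)
      (auto simp: has_real_derivative_iff_has_vector_derivative[symmetric] intro!: derivative_eq_intros)
  have "norm (integral {0..t} f) \<le> integral {0..t} (\<lambda>s. C * exp (l * s))"
    using bound int by (intro integral_norm_bound_integral integrable_continuous_real cont)
      (auto intro!: continuous_intros)
  also have "\<dots> = C / l * exp (l * t) - C / l"
    unfolding integral_unique[OF int] by simp
  also have "\<dots> \<le> C / l * exp (l * t)"
    using assms by simp
  finally show ?thesis .
qed

lemma integral_has_vector_derivative_half_line:
  fixes f :: "real \<Rightarrow> 'a::euclidean_space"
  assumes "continuous_on {0..} f" "0 \<le> t"
  shows "((\<lambda>u. integral {0..u} f) has_vector_derivative f t) (at t within {0..})"
proof -
  have "((\<lambda>u. integral {0..u} f) has_vector_derivative f t) (at t within {0..t + 1})"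
    using assms by (intro integral_has_vector_derivative) (auto intro: continuous_on_subset)
  also have "at t within {0..t + 1} = at t within {0..}"
    by (rule at_within_nhd[of _ "{..<t + 1}"]) auto
  finally show ?thesis .
qed

text \<open>Picard iteration on the whole half-line at once. With \<open>l > K\<close>, the integral operator
  \<open>x \<mapsto> x0 + \<integral> F(x)\<close> contracts the weighted norm \<open>sup\<^sub>t e\<^sup>-\<^sup>l\<^sup>t |x(t)|\<close> by \<open>K / l < 1\<close>, so that no
  local solutions have to be glued. The substitution \<open>y(t) = e\<^sup>-\<^sup>l\<^sup>t x(t)\<close> turns the weighted norm
  into the norm of the complete space of bounded continuous functions.\<close>

lemma lipschitz_ode_exists:
  fixes F :: "'a::euclidean_space \<Rightarrow> 'a"
  assumes lip: "K-lipschitz_on UNIV F"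
  obtains x where "x 0 = x0"
    and "\<And>t. 0 \<le> t \<Longrightarrow> (x has_vector_derivative F (x t)) (at t within {0..})"
proof -
  define l where "l = K + 1"
  have K: "0 \<le> K" and l: "0 < l" and Kl: "K / l < 1"
    using lipschitz_on_nonneg[OF lip] by (auto simp: l_def)
  have cancel: "exp (- l * u) * (a * exp (l * u)) = a" for a u :: real
  proof -
    have "exp (- l * u) * exp (l * u) = 1"
      by (simp flip: exp_add)
    then show ?thesis
      by (metis mult.assoc mult.commute mult_1)
  qed
  have contF: "continuous_on UNIV F"
    using lip by (rule lipschitz_on_continuous_on)
  \<comment> \<open>\<open>G\<close> is the Picard operator, expressed through the rescaled curve \<open>y\<close>; \<open>P\<close> rescales its value
    back and is constant at negative times, so as to be defined and continuous on the whole line.\<close>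
  define f where "f y s = F (exp (l * s) *\<^sub>R apply_bcontfun y s)" for y :: "real \<Rightarrow>\<^sub>C 'a" and s
  define G where "G y t = x0 + integral {0..t} (f y)" for y t
  define P where "P y t = exp (- l * max 0 t) *\<^sub>R G y (max 0 t)" for y t
  have contf: "continuous_on T (f y)" for T y
    unfolding f_def by (intro continuous_on_compose2[OF contF] continuous_intros) auto
  have derivG: "(G y has_vector_derivative f y t) (at t within {0..})" if "0 \<le> t" for y t
    unfolding G_def using integral_has_vector_derivative_half_line[OF contf that, of y]
    by (auto intro!: derivative_eq_intros)
  have contG: "continuous_on {0..} (G y)" for y
    using derivG by (force simp: continuous_on_eq_continuous_within intro: has_vector_derivative_continuous)
  have contP: "continuous_on UNIV (P y)" for y
    unfolding P_def by (intro continuous_intros continuous_on_compose2[OF contG]) auto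
  have boundP: "norm (P y t) \<le> norm x0 + (norm (F 0) + K * norm y) / l" for y t
  proof -
    define u where "u = max 0 t"
    have u: "0 \<le> u" by (simp add: u_def)
    have "norm (integral {0..u} (f y)) \<le> (norm (F 0) + K * norm y) / l * exp (l * u)"
    proof (rule norm_integral_le_exp[OF l u _ contf])
      fix s :: real assume s: "0 \<le> s"
      have "norm (f y s) \<le> norm (F 0) + norm (f y s - F 0)"
        by (metis add.commute diff_add_cancel norm_triangle_ineq)
      also have "norm (f y s - F 0) \<le> K * (exp (l * s) * norm (apply_bcontfun y s))"
        using lipschitz_onD[OF lip, of "exp (l * s) *\<^sub>R apply_bcontfun y s" 0]
        by (simp add: f_def dist_norm)
      also have "\<dots> \<le> K * (exp (l * s) * norm y)"
        by (intro mult_left_mono K norm_bounded) auto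
      also have "norm (F 0) \<le> norm (F 0) * exp (l * s)"
        using s l by (simp add: mult_le_cancel_left1)
      finally show "norm (f y s) \<le> (norm (F 0) + K * norm y) * exp (l * s)"
        by (simp add: algebra_simps)
    qed (use K in auto)
    then have "exp (- l * u) * norm (integral {0..u} (f y))
        \<le> exp (- l * u) * ((norm (F 0) + K * norm y) / l * exp (l * u))"
      by (rule mult_left_mono) simp
    also have "\<dots> = (norm (F 0) + K * norm y) / l"
      by (rule cancel)
    finally have *: "exp (- l * u) * norm (integral {0..u} (f y)) \<le> (norm (F 0) + K * norm y) / l" .
    have "norm (P y t) \<le> exp (- l * u) * (norm x0 + norm (integral {0..u} (f y)))"
      unfolding P_def G_def u_def[symmetric] norm_scaleR
      by (simp add: norm_triangle_ineq)
    also have "exp (- l * u) * norm x0 \<le> 1 * norm x0"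
      using u l by (intro mult_right_mono) auto
    then have "exp (- l * u) * (norm x0 + norm (integral {0..u} (f y)))
        \<le> norm x0 + (norm (F 0) + K * norm y) / l"
      using * by (simp add: distrib_left)
    finally show ?thesis .
  qed
  define \<Gamma> where "\<Gamma> y = Bcontfun (P y)" for y
  have \<Gamma>: "apply_bcontfun (\<Gamma> y) = P y" for y
    unfolding \<Gamma>_def using contP boundP by (intro Bcontfun_inverse bcontfun_normI)
  have contract: "dist (\<Gamma> y) (\<Gamma> z) \<le> K / l * dist y z" for y z
  proof (rule dist_bound)
    fix t :: real
    define u where "u = max 0 t"
    have u: "0 \<le> u" by (simp add: u_def)
    have "norm (integral {0..u} (\<lambda>s. f y s - f z s)) \<le> K * dist y z / l * exp (l * u)"
    proof (rule norm_integral_le_exp[OF l u])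
      fix s :: real
      have "norm (f y s - f z s) \<le> K * (exp (l * s) * dist (apply_bcontfun y s) (apply_bcontfun z s))"
        using lipschitz_onD[OF lip, of "exp (l * s) *\<^sub>R apply_bcontfun y s"
            "exp (l * s) *\<^sub>R apply_bcontfun z s"]
        by (simp add: f_def dist_norm flip: scaleR_diff_right)
      also have "\<dots> \<le> K * (exp (l * s) * dist y z)"
        by (intro mult_left_mono K dist_bounded) auto
      finally show "norm (f y s - f z s) \<le> K * dist y z * exp (l * s)"
        by (simp add: algebra_simps)
    qed (use K contf in \<open>auto intro!: continuous_intros\<close>)
    also have "integral {0..u} (\<lambda>s. f y s - f z s) = G y u - G z u"
      unfolding G_def by (simp add: integral_diff integrable_continuous_real contf)
    finally have *: "norm (G y u - G z u) \<le> K * dist y z / l * exp (l * u)" .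
    have "dist (\<Gamma> y t) (\<Gamma> z t) = exp (- l * u) * norm (G y u - G z u)"
      unfolding \<Gamma> P_def u_def[symmetric] dist_norm by (simp flip: scaleR_diff_right)
    also have "\<dots> \<le> exp (- l * u) * (K * dist y z / l * exp (l * u))"
      by (intro mult_left_mono *) simp
    also have "\<dots> = K / l * dist y z"
      unfolding cancel by simp
    finally show "dist (\<Gamma> y t) (\<Gamma> z t) \<le> K / l * dist y z" .
  qed
  obtain y where y: "\<Gamma> y = y"
    using banach_fix_type[of "K / l" \<Gamma>] K l Kl contract by auto
  define x where "x t = exp (l * t) *\<^sub>R apply_bcontfun y t" for t
  have x: "x t = G y t" if "0 \<le> t" for t
  proof -
    have "apply_bcontfun y t = P y t"
      using \<Gamma>[of y] y by simp
    then show ?thesis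
      using that by (simp add: x_def P_def exp_minus)
  qed
  show thesis
  proof
    show "x 0 = x0"
      by (simp add: x G_def)
    show "(x has_vector_derivative F (x t)) (at t within {0..})" if "0 \<le> t" for t
      using derivG[OF that, of y] x that
      by (intro has_vector_derivative_transform[of t "{0..}" x "G y"]) (auto simp: f_def x_def)
  qed
qed

text \<open>Gronwall's argument in both time directions: the squared distance \<open>g\<close> of the two solutions
  satisfies \<open>|g'| \<le> 2 K g\<close>, so \<open>e\<^sup>-\<^sup>2\<^sup>K\<^sup>s g(s)\<close> is nonincreasing and \<open>e\<^sup>2\<^sup>K\<^sup>s g(s)\<close> is nondecreasing. The first
  propagates the zero of \<open>g\<close> at \<open>r\<close> to later times, the second to earlier times.\<close>

lemma lipschitz_ode_meet_imp_eq:
  fixes x y :: "real \<Rightarrow> 'a::euclidean_space"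
  assumes lip: "K-lipschitz_on UNIV F"
    and dx: "\<And>t. 0 \<le> t \<Longrightarrow> (x has_vector_derivative F (x t)) (at t within {0..})"
    and dy: "\<And>t. 0 \<le> t \<Longrightarrow> (y has_vector_derivative F (y t)) (at t within {0..})"
    and meet: "0 \<le> r" "x r = y r" and t: "0 \<le> t"
  shows "x t = y t"
proof -
  define g where "g s = (x s - y s) \<bullet> (x s - y s)" for s
  define g' where "g' s = 2 * ((x s - y s) \<bullet> (F (x s) - F (y s)))" for s
  have contg: "continuous_on {a..b} g" if "0 \<le> a" for a b
  proof -
    have "continuous_on {0..} x" "continuous_on {0..} y"
      using dx dy
      by (force simp: continuous_on_eq_continuous_within intro: has_vector_derivative_continuous)+
    then show ?thesis
      unfolding g_def using that
      by (intro continuous_intros) (auto intro: continuous_on_subset)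
  qed
  have dg: "(g has_real_derivative g' s) (at s)" if "0 < s" for s
  proof -
    have *: "at s within {0..} = at s"
      using that by (intro at_within_interior) simp
    have "((\<lambda>s. x s - y s) has_vector_derivative F (x s) - F (y s)) (at s)"
      using dx[of s] dy[of s] that unfolding * by (intro has_vector_derivative_diff) simp_all
    then have d: "((\<lambda>s. x s - y s) has_derivative (\<lambda>h. h *\<^sub>R (F (x s) - F (y s)))) (at s)"
      by (simp add: has_vector_derivative_def)
    show ?thesis
      unfolding has_field_derivative_def g_def g'_def
      by (rule has_derivative_eq_rhs[OF has_derivative_inner[OF d d]])
        (simp add: fun_eq_iff inner_commute[of "F (x s) - F (y s)"])
  qed
  have bound: "\<bar>g' s\<bar> \<le> 2 * K * g s" for s
  proof -
    have F: "norm (F (x s) - F (y s)) \<le> K * norm (x s - y s)"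
      using lipschitz_onD[OF lip, of "x s" "y s"] by (simp add: dist_norm)
    have "\<bar>g' s\<bar> = 2 * \<bar>(x s - y s) \<bullet> (F (x s) - F (y s))\<bar>"
      by (simp add: g'_def abs_mult)
    also have "\<dots> \<le> 2 * (norm (x s - y s) * norm (F (x s) - F (y s)))"
      by (intro mult_left_mono Cauchy_Schwarz_ineq2) simp
    also have "\<dots> \<le> 2 * (norm (x s - y s) * (K * norm (x s - y s)))"
      by (intro mult_left_mono F) simp_all
    also have "\<dots> = 2 * K * g s"
      unfolding g_def dot_square_norm power2_eq_square by (simp only: mult_ac)
    finally show ?thesis .
  qed
  have g0: "0 \<le> g s" for s
    by (simp add: g_def)
  have "g t \<le> 0"
  proof (cases "r \<le> t")
    case True
    have "exp (- 2 * K * t) * g t \<le> exp (- 2 * K * r) * g r"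
    proof (rule DERIV_nonpos_imp_decreasing_open[OF True])
      fix s assume "r < s"
      then have "((\<lambda>s. exp (- 2 * K * s) * g s) has_real_derivative
          exp (- 2 * K * s) * (g' s - 2 * K * g s)) (at s)"
        using meet by (auto intro!: derivative_eq_intros dg simp: algebra_simps)
      moreover have "exp (- 2 * K * s) * (g' s - 2 * K * g s) \<le> 0"
        using bound[of s] by (auto intro!: mult_nonneg_nonpos)
      ultimately show "\<exists>d. ((\<lambda>s. exp (- 2 * K * s) * g s) has_real_derivative d) (at s) \<and> d \<le> 0"
        by blast
    qed (use meet in \<open>auto intro!: continuous_intros contg\<close>)
    then show ?thesis
      using meet by (simp add: g_def[of r] mult_le_0_iff)
  next
    case False
    then have tr: "t \<le> r" by simp
    have "exp (2 * K * t) * g t \<le> exp (2 * K * r) * g r"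
    proof (rule DERIV_nonneg_imp_increasing_open[OF tr])
      fix s assume "t < s"
      then have "((\<lambda>s. exp (2 * K * s) * g s) has_real_derivative
          exp (2 * K * s) * (g' s + 2 * K * g s)) (at s)"
        using t by (auto intro!: derivative_eq_intros dg simp: algebra_simps)
      moreover have "0 \<le> exp (2 * K * s) * (g' s + 2 * K * g s)"
        using bound[of s] by (auto intro!: mult_nonneg_nonneg)
      ultimately show "\<exists>d. ((\<lambda>s. exp (2 * K * s) * g s) has_real_derivative d) (at s) \<and> 0 \<le> d"
        by blast
    qed (use t in \<open>auto intro!: continuous_intros contg\<close>)
    then show ?thesis
      using meet by (simp add: g_def[of r] mult_le_0_iff)
  qed
  with g0[of t] have "g t = 0"
    by linarith
  then show ?thesis
    by (simp add: g_def)
qed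

section \<open>Regularity of the softmax vector field\<close>

text \<open>Moving each exponent by at most \<open>\<delta>\<close> changes numerator and denominator by factors between
  \<open>e\<^sup>-\<^sup>\<delta>\<close> and \<open>e\<^sup>\<delta>\<close>. This multiplicative bound yields the Lipschitz estimate below without any derivative.\<close>

lemma softmax_le_scaled_softmax:
  fixes a b :: "'d::finite \<Rightarrow> real"
  assumes "\<And>u. \<bar>a u - b u\<bar> \<le> \<delta>"
  shows "exp (a v) / (\<Sum>u\<in>UNIV. exp (a u)) \<le> exp (2 * \<delta>) * (exp (b v) / (\<Sum>u\<in>UNIV. exp (b u)))"
proof -
  have double: "exp (2 * \<delta>) = exp \<delta> * exp \<delta>"
    by (simp flip: exp_add)
  have num: "exp (a v) \<le> exp \<delta> * exp (b v)"
    using assms[of v] by (simp flip: exp_add)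
  have "exp (- \<delta>) * exp (b u) \<le> exp (a u)" for u
    using assms[of u] by (simp flip: exp_add)
  then have den: "exp (- \<delta>) * (\<Sum>u\<in>UNIV. exp (b u)) \<le> (\<Sum>u\<in>UNIV. exp (a u))"
    by (auto simp: sum_distrib_left intro: sum_mono)
  have pos: "0 < (\<Sum>u\<in>UNIV. exp (b u))"
    by (intro sum_pos) auto
  have "exp (a v) / (\<Sum>u\<in>UNIV. exp (a u))
      \<le> (exp \<delta> * exp (b v)) / (exp (- \<delta>) * (\<Sum>u\<in>UNIV. exp (b u)))"
    using num den pos by (intro frac_le) auto
  also have "\<dots> = exp (2 * \<delta>) * (exp (b v) / (\<Sum>u\<in>UNIV. exp (b u)))"
    unfolding double by (simp add: exp_minus field_simps)
  finally show ?thesis .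
qed

lemma abs_softmax_diff_le:
  fixes a b :: "'d::finite \<Rightarrow> real"
  assumes "\<And>u. \<bar>a u - b u\<bar> \<le> \<delta>"
  shows "\<bar>exp (a v) / (\<Sum>u\<in>UNIV. exp (a u)) - exp (b v) / (\<Sum>u\<in>UNIV. exp (b u))\<bar> \<le> 2 * \<delta>"
proof -
  \<comment> \<open>Stated for arbitrary exponents, to be used a second time with \<open>a\<close> and \<open>b\<close> exchanged.\<close>
  have one_sided: "exp (a v) / (\<Sum>u\<in>UNIV. exp (a u)) - exp (b v) / (\<Sum>u\<in>UNIV. exp (b u)) \<le> 2 * \<delta>"
    if close: "\<And>u. \<bar>a u - b u\<bar> \<le> \<delta>" for a b :: "'d \<Rightarrow> real"
  proof -
    let ?p = "exp (a v) / (\<Sum>u\<in>UNIV. exp (a u))" and ?q = "exp (b v) / (\<Sum>u\<in>UNIV. exp (b u))"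
    have \<delta>: "0 \<le> \<delta>"
      using close[of v] by linarith
    have "exp (a v) \<le> (\<Sum>u\<in>UNIV. exp (a u))"
      by (rule member_le_sum) auto
    then have p: "0 \<le> ?p" "?p \<le> 1"
      by (auto intro!: divide_nonneg_nonneg sum_nonneg divide_le_eq_1_pos[THEN iffD2] sum_pos)
    \<comment> \<open>From \<open>q \<ge> e\<^sup>-\<^sup>2\<^sup>\<delta> p\<close> and \<open>p \<le> 1\<close>: \<open>p - q \<le> (1 - e\<^sup>-\<^sup>2\<^sup>\<delta>) p \<le> 2 \<delta>\<close>.\<close>
    have "exp (- (2 * \<delta>)) * ?p \<le> exp (- (2 * \<delta>)) * (exp (2 * \<delta>) * ?q)"
      using softmax_le_scaled_softmax[OF close] by (intro mult_left_mono) auto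
    also have "\<dots> = ?q"
      by (simp add: exp_minus)
    finally have "?p - ?q \<le> (1 - exp (- (2 * \<delta>))) * ?p"
      by (simp only: left_diff_distrib mult_1)
    also have "\<dots> \<le> (2 * \<delta>) * 1"
      using exp_ge_add_one_self[of "- (2 * \<delta>)"] p \<delta> by (intro mult_mono) auto
    finally show ?thesis by simp
  qed
  have "\<bar>b u - a u\<bar> \<le> \<delta>" for u
    using assms[of u] by linarith
  then show ?thesis
    using one_sided[of a b] one_sided[of b a] assms by (auto simp: abs_le_iff)
qed

lemma abs_component2_le_norm: "\<bar>x $ i $ v\<bar> \<le> norm (x :: real ^ 'd ^ 'm)"
  by (metis component_le_norm_cart Finite_Cartesian_Product.norm_nth_le order_trans)

text \<open>The Lipschitz bound holds on the whole space, not only on the polysimplex. Thus existence can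
  be proved first, and that solutions stay in the polysimplex can be deduced from the equation.\<close>

lemma vector_field_lipschitz:
  fixes \<alpha> :: "'d::finite \<Rightarrow> 'm::finite \<Rightarrow> 'm \<Rightarrow> real"
  obtains K where "K-lipschitz_on UNIV (vector_field \<alpha>)"
proof -
  define A where "A = (\<Sum>u\<in>UNIV. \<Sum>i\<in>UNIV. \<Sum>j\<in>UNIV. \<bar>\<alpha> u i j\<bar>)"
  have A: "0 \<le> A"
    unfolding A_def by (intro sum_nonneg) auto
  have row: "(\<Sum>j\<in>UNIV. \<bar>\<alpha> u i j\<bar>) \<le> A" for u i
  proof -
    have "(\<Sum>j\<in>UNIV. \<bar>\<alpha> u i j\<bar>) \<le> (\<Sum>i\<in>UNIV. \<Sum>j\<in>UNIV. \<bar>\<alpha> u i j\<bar>)"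
      by (rule member_le_sum) (auto intro: sum_nonneg)
    also have "\<dots> \<le> A"
      unfolding A_def by (rule member_le_sum) (auto intro!: sum_nonneg)
    finally show ?thesis .
  qed
  have component: "\<bar>choice_map \<alpha> x $ i $ v - choice_map \<alpha> y $ i $ v\<bar> \<le> 2 * (A * norm (x - y))"
    for x y :: "real ^ 'd ^ 'm" and i v
    unfolding choice_map_def vec_lambda_beta
  proof (rule abs_softmax_diff_le)
    fix u
    have "\<bar>(\<Sum>j\<in>UNIV. \<alpha> u i j * x $ j $ u) - (\<Sum>j\<in>UNIV. \<alpha> u i j * y $ j $ u)\<bar>
        = \<bar>\<Sum>j\<in>UNIV. \<alpha> u i j * (x - y) $ j $ u\<bar>"
      by (simp add: algebra_simps sum_subtractf)
    also have "\<dots> \<le> (\<Sum>j\<in>UNIV. \<bar>\<alpha> u i j\<bar> * norm (x - y))"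
      by (rule order_trans[OF sum_abs])
        (auto simp: abs_mult simp del: vector_minus_component
          intro!: sum_mono mult_left_mono abs_component2_le_norm)
    also have "\<dots> \<le> A * norm (x - y)"
      using row by (auto simp: mult_right_mono simp flip: sum_distrib_right)
    finally show "\<bar>(\<Sum>j\<in>UNIV. \<alpha> u i j * x $ j $ u) - (\<Sum>j\<in>UNIV. \<alpha> u i j * y $ j $ u)\<bar>
        \<le> A * norm (x - y)" .
  qed
  define C where "C = real CARD('m) * (real CARD('d) * (2 * A))"
  have "C-lipschitz_on UNIV (choice_map \<alpha>)"
  proof (rule lipschitz_onI)
    fix x y :: "real ^ 'd ^ 'm"
    have "norm (choice_map \<alpha> x - choice_map \<alpha> y)
        \<le> (\<Sum>i\<in>UNIV. norm ((choice_map \<alpha> x - choice_map \<alpha> y) $ i))"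
      unfolding norm_vec_def[of "choice_map \<alpha> x - choice_map \<alpha> y"] by (rule L2_set_le_sum) simp
    also have "\<dots> \<le> (\<Sum>i\<in>(UNIV :: 'm set). \<Sum>v\<in>(UNIV :: 'd set). 2 * (A * norm (x - y)))"
      using component
      by (intro sum_mono order_trans[OF norm_le_l1_cart]) auto
    also have "\<dots> = C * norm (x - y)"
      by (simp add: C_def)
    finally show "dist (choice_map \<alpha> x) (choice_map \<alpha> y) \<le> C * dist x y"
      by (simp add: dist_norm)
  qed (use A in \<open>auto simp: C_def\<close>)
  then have "(1 + C)-lipschitz_on UNIV (\<lambda>x. - x + choice_map \<alpha> x)"
    by (intro lipschitz_on_add lipschitz_on_minus lipschitz_on_id)
  then show thesis
    by (intro that) (simp add: vector_field_def[abs_def])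
qed

section \<open>Trajectories in the polysimplex\<close>

lemma has_vector_derivative_component2:
  assumes "(x has_vector_derivative x') F"
  shows "((\<lambda>t. x t $ i $ v) has_real_derivative x' $ i $ v) F"
  using bounded_linear.has_vector_derivative[OF bounded_linear_compose[OF bounded_linear_vec_nth
      bounded_linear_vec_nth, of i v] assms]
  by (simp add: has_real_derivative_iff_has_vector_derivative)

lemma choice_map_pos: "0 < choice_map \<alpha> x $ i $ v"
  by (auto simp: choice_map_def intro!: divide_pos_pos sum_pos)

context
  fixes \<alpha> :: "'d::finite \<Rightarrow> 'm::finite \<Rightarrow> 'm \<Rightarrow> real" and x :: "real \<Rightarrow> real ^ 'd ^ 'm"
  assumes sol: "\<And>t. 0 \<le> t \<Longrightarrow> (x has_vector_derivative vector_field \<alpha> (x t)) (at t within {0..})"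
begin

lemma solution_component_continuous:
  assumes "0 \<le> a"
  shows "continuous_on {a..b} (\<lambda>t. x t $ i $ v)"
proof -
  have "continuous_on {0..} x"
    using sol by (force simp: continuous_on_eq_continuous_within intro: has_vector_derivative_continuous)
  then show ?thesis
    using assms by (intro continuous_intros) (auto intro: continuous_on_subset)
qed

lemma solution_has_vector_derivative:
  assumes "0 < t"
  shows "(x has_vector_derivative vector_field \<alpha> (x t)) (at t)"
proof -
  have "at t within {0..} = at t"
    using assms by (intro at_within_interior) simp
  then show ?thesis
    using sol[of t] assms by simp
qed

lemma solution_component_deriv:
  assumes "0 < t"
  shows "((\<lambda>t. x t $ i $ v) has_real_derivative choice_map \<alpha> (x t) $ i $ v - x t $ i $ v) (at t)"
  using has_vector_derivative_component2[OF solution_has_vector_derivative[OF assms], of i v]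
  by (simp add: vector_field_def)

text \<open>The factor \<open>e\<^sup>t\<close> removes the term \<open>-x\<close> of the field and leaves only \<open>\<pi> > 0\<close>.\<close>

lemma solution_component_strict_growth:
  assumes "0 \<le> s" "s < t"
  shows "exp s * x s $ i $ v < exp t * x t $ i $ v"
proof (rule DERIV_pos_imp_increasing_open[OF assms(2)])
  fix r assume "s < r"
  then have "((\<lambda>t. exp t * x t $ i $ v) has_real_derivative
      exp r * choice_map \<alpha> (x r) $ i $ v) (at r)"
    using assms by (auto intro!: derivative_eq_intros solution_component_deriv simp: algebra_simps)
  then show "\<exists>d. ((\<lambda>t. exp t * x t $ i $ v) has_real_derivative d) (at r) \<and> 0 < d"
    using choice_map_pos by (meson exp_gt_zero mult_pos_pos)
qed (use assms in \<open>auto intro!: continuous_intros solution_component_continuous\<close>)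

lemma solution_interior:
  assumes "x 0 \<in> polysimplex" "0 < t"
  shows "0 < x t $ i $ v"
proof -
  have "0 \<le> x 0 $ i $ v"
    using assms by (simp add: polysimplex_def prob_simplex_def)
  also have "\<dots> < exp t * x t $ i $ v"
    using solution_component_strict_growth[of 0 t i v] assms by simp
  finally show ?thesis
    by (simp add: zero_less_mult_iff)
qed

lemma solution_in_polysimplex:
  assumes "x 0 \<in> polysimplex" "0 \<le> t"
  shows "x t \<in> polysimplex"
proof (cases "t = 0")
  case False
  then have t: "0 < t"
    using assms by simp
  have "(\<Sum>v\<in>UNIV. x t $ i $ v) = 1" for i
  proof -
    define S where "S s = (\<Sum>v\<in>UNIV. x s $ i $ v)" for s
    \<comment> \<open>The row sum solves \<open>S' = 1 - S\<close>, so \<open>e\<^sup>s (S - 1)\<close> is constant.\<close>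
    have "exp t * (S t - 1) = exp 0 * (S 0 - 1)"
    proof (rule DERIV_isconst_end[OF t])
      show "continuous_on {0..t} (\<lambda>s. exp s * (S s - 1))"
        unfolding S_def by (intro continuous_intros solution_component_continuous) auto
      fix s :: real assume "0 < s"
      then have "(S has_real_derivative (\<Sum>v\<in>UNIV. choice_map \<alpha> (x s) $ i $ v - x s $ i $ v)) (at s)"
        unfolding S_def by (intro DERIV_sum solution_component_deriv)
      also have "(\<Sum>v\<in>UNIV. choice_map \<alpha> (x s) $ i $ v - x s $ i $ v) = 1 - S s"
        using choice_map_in_polysimplex[of \<alpha> "x s"]
        by (simp add: sum_subtractf S_def polysimplex_def prob_simplex_def)
      finally show "((\<lambda>s. exp s * (S s - 1)) has_real_derivative 0) (at s)"
        by (auto intro!: derivative_eq_intros simp: algebra_simps)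
    qed
    moreover have "S 0 = 1"
      using assms by (simp add: S_def polysimplex_def prob_simplex_def)
    ultimately show ?thesis
      by (simp add: S_def)
  qed
  then show ?thesis
    using solution_interior[OF assms(1) t] by (simp add: polysimplex_def prob_simplex_def less_imp_le)
qed (use assms in simp)

end

lemma is_trajectoryD:
  assumes "is_trajectory F x0 x"
  shows "x 0 = x0" and "0 \<le> t \<Longrightarrow> x t \<in> polysimplex"
    and "0 \<le> t \<Longrightarrow> (x has_vector_derivative F (x t)) (at t within {0..})"
  using assms by (simp_all add: is_trajectory_def)

text \<open>The semiflow is given by a definite description, so existence and uniqueness of the trajectory
  are both needed before anything can be said about its value.\<close>

lemma semiflow_trajectory:
  fixes \<alpha> :: "'d::finite \<Rightarrow> 'm::finite \<Rightarrow> 'm \<Rightarrow> real"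
  assumes x0: "x0 \<in> polysimplex"
  obtains x where "is_trajectory (vector_field \<alpha>) x0 x"
    and "\<And>t. 0 \<le> t \<Longrightarrow> semiflow (vector_field \<alpha>) t x0 = x t"
proof -
  obtain K where lip: "K-lipschitz_on UNIV (vector_field \<alpha>)"
    using vector_field_lipschitz .
  obtain x where x: "x 0 = x0"
      "\<And>t. 0 \<le> t \<Longrightarrow> (x has_vector_derivative vector_field \<alpha> (x t)) (at t within {0..})"
    using lipschitz_ode_exists[OF lip] by blast
  have traj: "is_trajectory (vector_field \<alpha>) x0 x"
    unfolding is_trajectory_def using x x0 solution_in_polysimplex[of x \<alpha>] by blast
  have "semiflow (vector_field \<alpha>) t x0 = x t" if t: "0 \<le> t" for t
    unfolding semiflow_def
  proof (rule the_equality)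
    fix z assume "\<exists>y. is_trajectory (vector_field \<alpha>) x0 y \<and> z = y t"
    then obtain y where y: "is_trajectory (vector_field \<alpha>) x0 y" "z = y t"
      by blast
    have "y t = x t"
      by (rule lipschitz_ode_meet_imp_eq[OF lip is_trajectoryD(3)[OF y(1)] x(2), of 0])
        (use is_trajectoryD(1)[OF y(1)] x(1) t in simp_all)
    then show "z = x t"
      using y by simp
  qed (use traj in blast)
  with traj show thesis
    by (rule that)
qed

text \<open>An equilibrium is itself a constant solution; a trajectory that reaches it at time \<open>t\<close>
  coincides with it at all times, in particular at time \<open>0\<close>.\<close>

lemma trajectory_avoids_equilibria:
  fixes \<alpha> :: "'d::finite \<Rightarrow> 'm::finite \<Rightarrow> 'm \<Rightarrow> real"
  assumes x: "is_trajectory (vector_field \<alpha>) x0 x" and ne: "vector_field \<alpha> x0 \<noteq> 0" and t: "0 \<le> t"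
  shows "vector_field \<alpha> (x t) \<noteq> 0"
proof
  assume eq: "vector_field \<alpha> (x t) = 0"
  obtain K where lip: "K-lipschitz_on UNIV (vector_field \<alpha>)"
    using vector_field_lipschitz .
  have const: "((\<lambda>_. x t) has_vector_derivative vector_field \<alpha> (x t)) (at s within {0..})" for s
    unfolding eq by (rule has_vector_derivative_const)
  have "x 0 = x t"
    by (rule lipschitz_ode_meet_imp_eq[OF lip is_trajectoryD(3)[OF x] const]) (use t in auto)
  then show False
    using ne eq is_trajectoryD(1)[OF x] by simp
qed

section \<open>The Lyapunov function along trajectories\<close>

lemma continuous_on_mult_ln: "continuous_on {0..} (\<lambda>x::real. x * ln x)"
  unfolding continuous_on_eq_continuous_within
proof
  fix x :: real assume x: "x \<in> {0..}"
  show "continuous (at x within {0..}) (\<lambda>x. x * ln x)"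
  proof (cases "x = 0")
    case True
    have "((\<lambda>x::real. x * ln x) \<longlongrightarrow> 0) (at_right 0)"
      by real_asymp
    moreover have "at (0::real) within {0..} = at_right 0"
      by (metis at_within_Ici_at_right)
    ultimately show ?thesis
      using True by (simp add: continuous_within)
  next
    case False
    then show ?thesis
      using x by (intro continuous_intros) auto
  qed
qed

lemma continuous_on_lyapunov_fun: "continuous_on polysimplex (lyapunov_fun \<alpha>)"
  unfolding lyapunov_fun_def
  by (intro continuous_intros continuous_on_compose2[OF continuous_on_mult_ln])
    (auto simp: polysimplex_def prob_simplex_def)

text \<open>The product rule gives two sums for the quadratic part, which the symmetry of \<open>\<alpha>\<close> makes
  equal; this is what the factor \<open>1 / 2\<close> in the Lyapunov function compensates.\<close>

lemma lyapunov_fun_has_derivative: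
  fixes \<alpha> :: "'d::finite \<Rightarrow> 'm::finite \<Rightarrow> 'm \<Rightarrow> real" and x :: "real \<Rightarrow> real ^ 'd ^ 'm"
  assumes sym: "\<And>v i j. \<alpha> v i j = \<alpha> v j i"
    and dx: "(x has_vector_derivative w) (at t)" and pos: "\<And>i v. 0 < x t $ i $ v"
  shows "((\<lambda>t. lyapunov_fun \<alpha> (x t)) has_real_derivative
    (\<Sum>i\<in>UNIV. \<Sum>v\<in>UNIV. (ln (x t $ i $ v) + 1 - (\<Sum>j\<in>UNIV. \<alpha> v i j * x t $ j $ v)) * w $ i $ v)) (at t)"
proof -
  note d = has_vector_derivative_component2[OF dx]
  let ?E = "\<Sum>i\<in>UNIV. \<Sum>v\<in>UNIV. (ln (x t $ i $ v) + 1) * w $ i $ v"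
  let ?Q = "\<Sum>i\<in>UNIV. \<Sum>j\<in>UNIV. \<Sum>v\<in>UNIV. \<alpha> v i j * (w $ i $ v * x t $ j $ v)"
  have entropy: "((\<lambda>t. x t $ i $ v * ln (x t $ i $ v)) has_real_derivative
      (ln (x t $ i $ v) + 1) * w $ i $ v) (at t)" for i v
    using pos[of i v] by (auto intro!: derivative_eq_intros d simp: field_simps)
  have quadratic: "((\<lambda>t. \<alpha> v i j * x t $ i $ v * x t $ j $ v) has_real_derivative
      \<alpha> v i j * (w $ i $ v * x t $ j $ v) + \<alpha> v i j * (w $ j $ v * x t $ i $ v)) (at t)" for i j v
    by (auto intro!: derivative_eq_intros d simp: algebra_simps)
  have "((\<lambda>t. lyapunov_fun \<alpha> (x t)) has_real_derivative ?E - 1 / 2 *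
      (\<Sum>i\<in>UNIV. \<Sum>j\<in>UNIV. \<Sum>v\<in>UNIV.
        \<alpha> v i j * (w $ i $ v * x t $ j $ v) + \<alpha> v i j * (w $ j $ v * x t $ i $ v))) (at t)"
    unfolding lyapunov_fun_def
    by (intro DERIV_diff DERIV_cmult DERIV_sum entropy quadratic)
  also have "(\<Sum>i\<in>UNIV. \<Sum>j\<in>UNIV. \<Sum>v\<in>UNIV.
        \<alpha> v i j * (w $ i $ v * x t $ j $ v) + \<alpha> v i j * (w $ j $ v * x t $ i $ v))
      = ?Q + (\<Sum>i\<in>UNIV. \<Sum>j\<in>UNIV. \<Sum>v\<in>UNIV. \<alpha> v j i * (w $ j $ v * x t $ i $ v))"
    by (simp only: sum.distrib) (subst (2) sym, rule refl)
  also have "(\<Sum>i\<in>UNIV. \<Sum>j\<in>UNIV. \<Sum>v\<in>UNIV. \<alpha> v j i * (w $ j $ v * x t $ i $ v)) = ?Q"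
    by (rule sum.swap)
  also have "?E - 1 / 2 * (?Q + ?Q) = ?E - ?Q"
    by simp
  also have "?Q = (\<Sum>i\<in>UNIV. \<Sum>v\<in>UNIV. (\<Sum>j\<in>UNIV. \<alpha> v i j * x t $ j $ v) * w $ i $ v)"
  proof (rule sum.cong[OF refl])
    fix i
    show "(\<Sum>j\<in>UNIV. \<Sum>v\<in>UNIV. \<alpha> v i j * (w $ i $ v * x t $ j $ v))
        = (\<Sum>v\<in>UNIV. (\<Sum>j\<in>UNIV. \<alpha> v i j * x t $ j $ v) * w $ i $ v)"
      by (subst sum.swap) (simp add: sum_distrib_left sum_distrib_right mult_ac)
  qed
  also have "?E - \<dots> = (\<Sum>i\<in>UNIV. \<Sum>v\<in>UNIV.
      (ln (x t $ i $ v) + 1 - (\<Sum>j\<in>UNIV. \<alpha> v i j * x t $ j $ v)) * w $ i $ v)"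
    by (simp add: left_diff_distrib sum_subtractf)
  finally show ?thesis .
qed

lemma ln_choice_map:
  "ln (choice_map \<alpha> x $ i $ v)
    = (\<Sum>j\<in>UNIV. \<alpha> v i j * x $ j $ v) - ln (\<Sum>u\<in>UNIV. exp (\<Sum>j\<in>UNIV. \<alpha> u i j * x $ j $ u))"
proof -
  have "0 < (\<Sum>u\<in>UNIV. exp (\<Sum>j\<in>UNIV. \<alpha> u i j * x $ j $ u))"
    by (intro sum_pos) auto
  then show ?thesis
    by (simp add: choice_map_def ln_div)
qed

text \<open>Both \<open>1\<close> and the logarithm of the normalising constant of \<open>\<pi>\<^sup>i\<close> do not depend on \<open>v\<close>, so they
  are invisible to a tangent vector. What remains is the derivative, in direction \<open>w\<close>, of the
  relative entropy of \<open>x\<close> with respect to \<open>\<pi>(x)\<close> held fixed.\<close>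

lemma lyapunov_derivative_relative_entropy:
  fixes \<alpha> :: "'d::finite \<Rightarrow> 'm::finite \<Rightarrow> 'm \<Rightarrow> real"
  assumes "w \<in> polysimplex_tangent"
  shows "(\<Sum>i\<in>UNIV. \<Sum>v\<in>UNIV. (ln (x $ i $ v) + 1 - (\<Sum>j\<in>UNIV. \<alpha> v i j * x $ j $ v)) * w $ i $ v)
    = (\<Sum>i\<in>UNIV. \<Sum>v\<in>UNIV. (ln (x $ i $ v) - ln (choice_map \<alpha> x $ i $ v)) * w $ i $ v)"
proof (rule sum.cong[OF refl])
  fix i
  define c where "c = ln (\<Sum>u\<in>UNIV. exp (\<Sum>j\<in>UNIV. \<alpha> u i j * x $ j $ u))"
  note c = ln_choice_map[of \<alpha> x i, folded c_def]
  have "(\<Sum>v\<in>UNIV. (ln (x $ i $ v) + 1 - (\<Sum>j\<in>UNIV. \<alpha> v i j * x $ j $ v)) * w $ i $ v)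
      = (\<Sum>v\<in>UNIV. (ln (x $ i $ v) - ln (choice_map \<alpha> x $ i $ v)) * w $ i $ v + (1 - c) * w $ i $ v)"
    by (simp add: c algebra_simps)
  also have "\<dots> = (\<Sum>v\<in>UNIV. (ln (x $ i $ v) - ln (choice_map \<alpha> x $ i $ v)) * w $ i $ v)"
    using assms by (simp add: sum.distrib polysimplex_tangent_def flip: sum_distrib_left)
  finally show "(\<Sum>v\<in>UNIV. (ln (x $ i $ v) + 1 - (\<Sum>j\<in>UNIV. \<alpha> v i j * x $ j $ v)) * w $ i $ v)
      = (\<Sum>v\<in>UNIV. (ln (x $ i $ v) - ln (choice_map \<alpha> x $ i $ v)) * w $ i $ v)" .
qed

lemma ln_diff_mult_diff_neg:
  fixes a b :: real
  assumes "0 < a" "0 < b" "a \<noteq> b"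
  shows "(ln a - ln b) * (b - a) < 0"
  using assms by (cases "a < b") (auto simp: mult_less_0_iff)

lemma lyapunov_derivative_neg:
  fixes \<alpha> :: "'d::finite \<Rightarrow> 'm::finite \<Rightarrow> 'm \<Rightarrow> real"
  assumes x: "x \<in> polysimplex" and pos: "\<And>i v. 0 < x $ i $ v" and ne: "vector_field \<alpha> x \<noteq> 0"
  shows "(\<Sum>i\<in>UNIV. \<Sum>v\<in>UNIV. (ln (x $ i $ v) + 1 - (\<Sum>j\<in>UNIV. \<alpha> v i j * x $ j $ v))
    * vector_field \<alpha> x $ i $ v) < 0"
proof -
  let ?p = "choice_map \<alpha> x"
  define T where "T i v = (ln (x $ i $ v) - ln (?p $ i $ v)) * (?p $ i $ v - x $ i $ v)" for i v
  have T: "T i v \<le> 0" for i v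
    using ln_diff_mult_diff_neg[OF pos choice_map_pos, of i v \<alpha> x i v]
    by (cases "x $ i $ v = ?p $ i $ v") (auto simp: T_def less_imp_le)
  obtain i v where iv: "x $ i $ v \<noteq> ?p $ i $ v"
    using ne by (auto simp: vector_field_def vec_eq_iff) metis
  have "T i v < 0"
    using ln_diff_mult_diff_neg[OF pos choice_map_pos iv] by (simp add: T_def)
  then have "(\<Sum>v\<in>UNIV. T i v) < 0"
    using sum_strict_mono_ex1[of UNIV "T i" "\<lambda>_. 0"] T by auto
  moreover have "(\<Sum>v\<in>UNIV. T i v) \<le> 0" for i
    using T by (intro sum_nonpos) auto
  ultimately have "(\<Sum>i\<in>UNIV. \<Sum>v\<in>UNIV. T i v) < 0"
    using sum_strict_mono_ex1[of UNIV "\<lambda>i. \<Sum>v\<in>UNIV. T i v" "\<lambda>_. 0"] by auto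
  then show ?thesis
    unfolding lyapunov_derivative_relative_entropy[OF vector_field_in_tangent[OF x]]
    by (simp add: T_def vector_field_def)
qed

theorem theorem1:
  fixes \<alpha> :: "'d::finite \<Rightarrow> 'm::finite \<Rightarrow> 'm \<Rightarrow> real"
  assumes "CARD('m) \<ge> 2"
    and "CARD('d) \<ge> 2"
    and "\<And>v i j. \<alpha> v i j = \<alpha> v j i"
  shows "strict_lyapunov (vector_field \<alpha>) (lyapunov_fun \<alpha>)"
  unfolding strict_lyapunov_def
proof (intro conjI ballI continuous_on_lyapunov_fun)
  fix x0 :: "real ^ 'd ^ 'm"
  assume "x0 \<in> polysimplex - equilibria (vector_field \<alpha>)"
  then have x0: "x0 \<in> polysimplex" and ne: "vector_field \<alpha> x0 \<noteq> 0"
    by (auto simp: equilibria_def)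
  obtain x where x: "is_trajectory (vector_field \<alpha>) x0 x"
    and flow: "\<And>t. 0 \<le> t \<Longrightarrow> semiflow (vector_field \<alpha>) t x0 = x t"
    using semiflow_trajectory[OF x0] by blast
  have sol: "(x has_vector_derivative vector_field \<alpha> (x t)) (at t within {0..})"
    and mem: "x t \<in> polysimplex" if "0 \<le> t" for t
    using is_trajectoryD[OF x] that by blast+
  have contx: "continuous_on {0..} x"
    using sol by (force simp: continuous_on_eq_continuous_within intro: has_vector_derivative_continuous)
  have "lyapunov_fun \<alpha> (x t) < lyapunov_fun \<alpha> (x s)" if st: "0 \<le> s" "s < t" for s t
  proof (rule DERIV_neg_imp_decreasing_open[OF st(2)])
    show "continuous_on {s..t} (\<lambda>r. lyapunov_fun \<alpha> (x r))"
      using st mem contx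
      by (intro continuous_on_compose2[OF continuous_on_lyapunov_fun]) (auto intro: continuous_on_subset)
    fix r assume "s < r"
    then have r: "0 < r"
      using st by simp
    have pos: "0 < x r $ i $ v" for i v
      using solution_interior[OF sol _ r] mem[of 0] by simp
    show "\<exists>d. ((\<lambda>r. lyapunov_fun \<alpha> (x r)) has_real_derivative d) (at r) \<and> d < 0"
      using lyapunov_fun_has_derivative[OF assms(3) solution_has_vector_derivative[OF sol r] pos]
        lyapunov_derivative_neg[OF mem pos trajectory_avoids_equilibria[OF x ne]] r
      by (meson less_imp_le)
  qed
  then show "strict_antimono_on {0..} (\<lambda>t. lyapunov_fun \<alpha> (semiflow (vector_field \<alpha>) t x0))"
    by (auto simp: monotone_on_def flow)
qed

end
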